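(* Let $m\ge 1$, $0<\alpha\le 1$, and let the Lagrangian $L:[a,b]\times\mathbb{R}^{n\times(m+1)}\to\mathbb{R}$ be of class $C^{2m}$ with respect to all its arguments. Consider the problem of finding stationary values of the integral functional $$I^m[q(\cdot)]=\frac{1}{\Gamma(\alpha)}\int_a^t L\left(\theta,q(\theta),\dot q(\theta),\dots,q^{(m)}(\theta)\right)(t-\theta)^{\alpha-1}\,d\theta$$ subject to the initial conditions $q^{(i)}(a)=q^i_a$, $i=0,\dots,m-1$. A necessary condition for $q(\cdot)$ to be a solution to this problem is given by the higher-order DuBois-Reymond condition $$\frac{d}{d\theta}\left\{L\left(\theta,q(\theta),\dot q(\theta),\dots,q^{(m)}(\theta)\right)-\sum_{j=1}^m\psi^j\cdot q^{(j)}(\theta)\right\}=\partial_1L\left(\theta,q(\theta),\dot q(\theta),\dots,q^{(m)}(\theta)\right)+F\left(\theta,q(\theta),\dot q(\theta),\dots,q^{(2m-1)}(\theta)\right)\cdot\dot q(\theta),$$ where, for $j=1,\dots,m$, $$\psi^j=\sum_{i=0}^{m-j}(-1)^i\frac{d^i}{d\theta^i}\,\partial_{i+j+2}L\left(\theta,q(\theta),\dot q(\theta),\dots,q^{(m)}(\theta)\right),$$ and $$F\left(\theta,q(\theta),\dot q(\theta),\dots,q^{(2m-1)}(\theta)\right)=\frac{1-\alpha}{t-\theta}\sum_{i=1}^{m} i(-1)^{i-1}\frac{d^{i-1}}{d\theta^{i-1}}\,\partial_{i+2}L+\sum_{k=2}^{m}\sum_{i=2}^{k}(-1)^{i-1}\frac{\Gamma(i-\alpha+1)}{(t-\theta)^i\,\Gamma(1-\alpha)}\binom{k}{k-i}\frac{d^{k-i}}{d\theta^{k-i}}\,\partial_{k+2}L,$$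 with the partial derivatives of $L$ in $F$ evaluated at $(\theta,q(\theta),\dot q(\theta),\dots,q^{(m)}(\theta))$.
   Context: $\Gamma$ is the Euler gamma function. $\theta$ is the intrinsic time and $t$ is the observer time, with $t\ne\theta$. $q^{(0)}=q$ and, for $i\ge 1$, $q^{(i)}$ is the $i$-th derivative of $q$, which takes values in $\mathbb{R}^n$. $\partial_i L$ denotes the partial derivative of $L$ with respect to its $i$-th argument, so $\partial_1L=\partial L/\partial\theta$ and $\partial_{i+2}L=\partial L/\partial q^{(i)}$. The operators $d^i/d\theta^i$ are total derivatives along $\theta\mapsto(\theta,q(\theta),\dots,q^{(m)}(\theta))$, and $\cdot$ is the inner product in $\mathbb{R}^n$. For $\alpha=1$ one has $F=0$. The double sum is empty when $m=1$. "$q(\cdot)$ is a solution" means that $q(\cdot)$ satisfies the initial conditions and gives a stationary value to $I^m$: the first variation $$\delta I^m[q(\cdot)]=\frac{1}{\Gamma(\alpha)}\int_a^t\left(\sum_{i=0}^m\partial_{i+2}L\cdot\delta q^{(i)}\right)(t-\theta)^{\alpha-1}\,d\theta$$ vanishes for the variations $\delta q^{(i)}\in C^{2m}([a,b];\mathbb{R}^n)$ of $q^{(i)}$ compatible with the initial conditions, that is, with $\delta q^{(i)}(a)=0$ for $i=0,\dots,m-1$.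
   Formalization: In the double sum of F the sign (-1)^{i-1} is replaced by (-1)^{k-1}; as printed the condition fails for m=3, α=1/2, t=1 on [0,1], L=(1-θ)^4 q'''-(105/8)(1-θ)q, q(θ)=θ at θ=0 (87/8 against 231/8); for m≤2 or α=1 the two agree. *)

theory Defs
  imports "HOL-Analysis.Analysis"
begin

text \<open>
  Functions of class $C^r$ on a set \<open>S\<close>, by iterated directional derivatives taken within \<open>S\<close>.
  It is used for finite-dimensional domains and convex \<open>S\<close> with non-empty interior
  (\<open>{a..b}\<close> and \<open>{a..b} \<times> UNIV\<close> with \<open>a < b\<close>), where the derivative within \<open>S\<close> is unique; at the
  endpoints of \<open>{a..b}\<close> derivatives are one-sided.
\<close>

primrec C_class_on ::
  "nat \<Rightarrow> 'a::euclidean_space set \<Rightarrow> ('a \<Rightarrow> 'b::real_normed_vector) \<Rightarrow> bool" where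
  "C_class_on 0 S f \<longleftrightarrow> continuous_on S f"
| "C_class_on (Suc r) S f \<longleftrightarrow>
     f differentiable_on S \<and> (\<forall>v. C_class_on r S (\<lambda>x. frechet_derivative f (at x within S) v))"

primrec nth_deriv ::
  "real set \<Rightarrow> nat \<Rightarrow> (real \<Rightarrow> 'a::real_normed_vector) \<Rightarrow> real \<Rightarrow> 'a" where
  "nth_deriv S 0 f = f"
| "nth_deriv S (Suc i) f = (\<lambda>s. vector_derivative (nth_deriv S i f) (at s within S))"

text \<open>
  A Lagrangian is a function \<open>L :: real \<times> ((real^'n)^'k) \<Rightarrow> real\<close> with \<open>CARD('k) = m + 1\<close>.
  The bijection \<open>e\<close> from \<open>{0..m}\<close> to \<open>'k\<close> names the slots: slot \<open>e i\<close> holds $q^{(i)}$. Thus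
  \<open>pd_time S L\<close> is $\partial_1 L$ and \<open>pd_slot L (e i)\<close> is $\partial_{i+2} L$, a vector in
  $\mathbb{R}^n$.
\<close>

definition jet ::
  "(nat \<Rightarrow> 'k::finite) \<Rightarrow> nat \<Rightarrow> real set \<Rightarrow> (real \<Rightarrow> real^'n) \<Rightarrow> real \<Rightarrow> real \<times> ((real^'n)^'k)" where
  "jet e m S q \<theta> = (\<theta>, \<chi> k. nth_deriv S (the_inv_into {0..m} e k) q \<theta>)"

definition pd_time :: "real set \<Rightarrow> (real \<times> ((real^'n)^'k) \<Rightarrow> real) \<Rightarrow> real \<times> ((real^'n)^'k) \<Rightarrow> real" where
  "pd_time S L = (\<lambda>(\<theta>, x). vector_derivative (\<lambda>s. L (s, x)) (at \<theta> within S))"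

definition pd_slot ::
  "(real \<times> ((real^'n)^'k) \<Rightarrow> real) \<Rightarrow> 'k::finite \<Rightarrow> real \<times> ((real^'n)^'k) \<Rightarrow> real^'n" where
  "pd_slot L k = (\<lambda>(\<theta>, x). \<chi> j. deriv (\<lambda>s. L (\<theta>, x + s *\<^sub>R axis k (axis j 1))) 0)"

text \<open>
  The first variation at \<open>q\<close> in the direction \<open>h\<close> ($\delta q^{(i)} = h^{(i)}$) of the action
  $\frac{1}{\Gamma(\alpha)} \int_a^t L(\theta, q, \dots, q^{(m)}) (t - \theta)^{\alpha - 1} d\theta$
  with fixed observer time \<open>t\<close>.
\<close>

definition first_variation ::
  "(real \<times> ((real^'n)^'k) \<Rightarrow> real) \<Rightarrow> (nat \<Rightarrow> 'k::finite) \<Rightarrow> nat \<Rightarrow> real \<Rightarrow> real \<Rightarrow> real \<Rightarrow> real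
    \<Rightarrow> (real \<Rightarrow> real^'n) \<Rightarrow> (real \<Rightarrow> real^'n) \<Rightarrow> real" where
  "first_variation L e m \<alpha> a b t q h =
     1 / Gamma \<alpha> *
       integral {a..t} (\<lambda>\<theta>.
         (\<Sum>i=0..m. pd_slot L (e i) (jet e m {a..b} q \<theta>) \<bullet> nth_deriv {a..b} i h \<theta>)
           * (t - \<theta>) powr (\<alpha> - 1))"

definition admissible_variation :: "nat \<Rightarrow> real \<Rightarrow> real \<Rightarrow> (real \<Rightarrow> real^'n) \<Rightarrow> bool" where
  "admissible_variation m a b h \<longleftrightarrow>
     (\<forall>i\<le>m. C_class_on (2 * m) {a..b} (nth_deriv {a..b} i h)) \<and>
     (\<forall>i<m. nth_deriv {a..b} i h a = 0)"

definition is_solution ::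
  "(real \<times> ((real^'n)^'k) \<Rightarrow> real) \<Rightarrow> (nat \<Rightarrow> 'k::finite) \<Rightarrow> nat \<Rightarrow> real \<Rightarrow> real \<Rightarrow> real \<Rightarrow> real
    \<Rightarrow> (nat \<Rightarrow> real^'n) \<Rightarrow> (real \<Rightarrow> real^'n) \<Rightarrow> bool" where
  "is_solution L e m \<alpha> a b t qa q \<longleftrightarrow>
     (\<forall>i<m. nth_deriv {a..b} i q a = qa i) \<and>
     (\<forall>h. admissible_variation m a b h \<longrightarrow> first_variation L e m \<alpha> a b t q h = 0)"

definition psi ::
  "(real \<times> ((real^'n)^'k) \<Rightarrow> real) \<Rightarrow> (nat \<Rightarrow> 'k::finite) \<Rightarrow> nat \<Rightarrow> real set
    \<Rightarrow> (real \<Rightarrow> real^'n) \<Rightarrow> nat \<Rightarrow> real \<Rightarrow> real^'n" where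
  "psi L e m S q j \<theta> =
     (\<Sum>i=0..m - j. (-1) ^ i *\<^sub>R nth_deriv S i (\<lambda>s. pd_slot L (e (i + j)) (jet e m S q s)) \<theta>)"

text \<open>
  With $w(\theta) = (t - \theta)^{\alpha - 1}$ and
  $w^{(i)} / w = \Gamma(i - \alpha + 1) / (\Gamma(1 - \alpha) (t - \theta)^i)$, the term below
  is what Leibniz' rule leaves of $-\frac{1}{w} \sum_k (-1)^k \frac{d^k}{d\theta^k}
  (w \, \partial_{k+2} L)$ once the terms in which \<open>w\<close> is not differentiated are removed; the first
  sum collects $w'$, the second one the higher derivatives of \<open>w\<close>. Hence the sign in the second
  sum is $(-1)^{k-1}$ with the outer index \<open>k\<close>. The variant $(-1)^{i-1}$ with the inner index
  agrees with it for \<open>m \<le> 2\<close> and does not give a necessary condition for \<open>m = 3\<close>.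
  For \<open>\<alpha> = 1\<close> both sums vanish, since \<open>Gamma 0 = 0\<close> and division by \<open>0\<close> yields \<open>0\<close>.
\<close>

definition fractional_force ::
  "(real \<times> ((real^'n)^'k) \<Rightarrow> real) \<Rightarrow> (nat \<Rightarrow> 'k::finite) \<Rightarrow> nat \<Rightarrow> real \<Rightarrow> real set \<Rightarrow> real
    \<Rightarrow> (real \<Rightarrow> real^'n) \<Rightarrow> real \<Rightarrow> real^'n" where
  "fractional_force L e m \<alpha> S t q \<theta> =
     ((1 - \<alpha>) / (t - \<theta>)) *\<^sub>R
       (\<Sum>i=1..m. (real i * (-1) ^ (i - 1)) *\<^sub>R
          nth_deriv S (i - 1) (\<lambda>s. pd_slot L (e i) (jet e m S q s)) \<theta>)
     + (\<Sum>k=2..m. \<Sum>i=2..k.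
          ((-1) ^ (k - 1) * (Gamma (real i - \<alpha> + 1) / ((t - \<theta>) ^ i * Gamma (1 - \<alpha>)))
            * real (k choose (k - i))) *\<^sub>R
          nth_deriv S (k - i) (\<lambda>s. pd_slot L (e k) (jet e m S q s)) \<theta>)"

end

theory Submission
  imports Defs
begin

text \<open>
  The condition follows from the Euler-Lagrange equation of the weighted problem. Write
  $p_i = \partial_{i+2} L$ along the jet of \<open>q\<close>, $w(\theta) = (t - \theta)^{\alpha - 1}$, and extend
  $\psi^j$ to $j = 0$, so that $\psi^0 = \sum_i (-1)^i p_i^{(i)}$.
  
  For any coefficients $P_0, \dots, P_m$ and any curve $h$, put
  $\Psi^j = \sum_{i=0}^{m-j} (-1)^i P_{i+j}^{(i)}$. As $(\Psi^j)' = P_{j-1} - \Psi^{j-1}$, telescoping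
  yields
  $$\frac{d}{d\theta} \sum_{j=1}^m \Psi^j \cdot h^{(j-1)} = \sum_{i=0}^m P_i \cdot h^{(i)} - \Psi^0 \cdot h$$
  (lemma \<open>momentum_derivative\<close>). This identity is used twice.
  
  With $P_i = w p_i$ and $h$ a bump supported in a compact subinterval of $]a, t[$, integrating it turns
  the first variation into $\int \Psi^0 \cdot h$. Hence $\sum_i (-1)^i (w p_i)^{(i)} = 0$ on $[a, t[$
  (lemma \<open>higher_order_Euler_Lagrange\<close>). Expanding by Leibniz' rule and dividing by $w$ gives
  $\psi^0 = F$ (lemma \<open>weighted_Euler_Lagrange_eq_psi_minus_force\<close>).
  
  With $P_i = p_i$ and $h = \dot q$, it gives
  $\frac{d}{d\theta} \sum_j \psi^j \cdot q^{(j)} = \sum_i p_i \cdot q^{(i+1)} - \psi^0 \cdot \dot q$. The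
  chain rule gives $\frac{d}{d\theta} L = \partial_1 L + \sum_i p_i \cdot q^{(i+1)}$ (lemma
  \<open>Lagrangian_along_jet_derivative\<close>). Subtracting and inserting $\psi^0 = F$ proves the claim.
\<close>

section \<open>Curves of class $C^r$\<close>

text \<open>
  Curves of class $C^r$ on a set of reals, by existence of a chain of vector derivatives instead of
  iterated Frechet derivatives. Products and sums of curves then need no uniqueness of derivatives;
  uniqueness enters only in the comparison with \<open>C_class_on\<close> and \<open>nth_deriv\<close> on a non-degenerate
  interval.
\<close>

primrec C_curve :: "nat \<Rightarrow> real set \<Rightarrow> (real \<Rightarrow> 'a::real_normed_vector) \<Rightarrow> bool" where
  "C_curve 0 S f \<longleftrightarrow> continuous_on S f"
| "C_curve (Suc r) S f \<longleftrightarrow>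
     (\<exists>g. (\<forall>s\<in>S. (f has_vector_derivative g s) (at s within S)) \<and> C_curve r S g)"

lemma C_curve_SucI:
  assumes "\<And>s. s \<in> S \<Longrightarrow> (f has_vector_derivative g s) (at s within S)" and "C_curve r S g"
  shows "C_curve (Suc r) S f"
  using assms by auto

lemma C_curve_cong:
  assumes "\<And>s. s \<in> S \<Longrightarrow> f s = g s" and "C_curve r S f"
  shows "C_curve r S g"
proof (cases r)
  case 0
  then show ?thesis using assms continuous_on_cong[OF refl, of S f g] by auto
next
  case (Suc k)
  then obtain f' where "\<forall>s\<in>S. (f has_vector_derivative f' s) (at s within S)" "C_curve k S f'"
    using assms(2) by auto
  then have "\<forall>s\<in>S. (g has_vector_derivative f' s) (at s within S)"
    using assms(1) has_vector_derivative_transform[of _ S g f] by simp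
  then show ?thesis using Suc \<open>C_curve k S f'\<close> by auto
qed

lemma C_curve_imp_continuous_on: "C_curve r S f \<Longrightarrow> continuous_on S f"
  by (cases r) (auto simp: continuous_on_eq_continuous_within
      intro: has_vector_derivative_continuous)

lemma C_curve_Suc_imp: "C_curve (Suc r) S f \<Longrightarrow> C_curve r S f"
proof (induction r arbitrary: f)
  case 0
  then show ?case using C_curve_imp_continuous_on by fastforce
next
  case (Suc r)
  then obtain g where "\<forall>s\<in>S. (f has_vector_derivative g s) (at s within S)" "C_curve (Suc r) S g"
    by (auto simp only: C_curve.simps(2))
  then show ?case using Suc.IH[of g] by auto
qed

lemma C_curve_mono: "C_curve r S f \<Longrightarrow> k \<le> r \<Longrightarrow> C_curve k S f"
proof (induction r)
  case (Suc r)
  then show ?case using C_curve_Suc_imp[of r S f] by (cases "k = Suc r") auto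
qed simp

lemma C_curve_const: "C_curve r S (\<lambda>s. c)"
  by (induction r arbitrary: c) (auto intro!: derivative_intros exI[of _ "\<lambda>s. 0"])

lemma C_curve_ident: "C_curve r S (\<lambda>s. s)"
proof (cases r)
  case (Suc k)
  then show ?thesis
    by (auto intro!: C_curve_SucI[of _ _ "\<lambda>s. 1"] C_curve_const derivative_intros simp del: C_curve.simps)
qed simp

lemma C_curve_add:
  "C_curve r S f \<Longrightarrow> C_curve r S g \<Longrightarrow> C_curve r S (\<lambda>s. f s + g s)"
proof (induction r arbitrary: f g)
  case (Suc r)
  then obtain f' g' where
    "\<forall>s\<in>S. (f has_vector_derivative f' s) (at s within S)" "C_curve r S f'"
    "\<forall>s\<in>S. (g has_vector_derivative g' s) (at s within S)" "C_curve r S g'"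
    by auto
  then show ?case using Suc.IH[of f' g']
    by (auto intro!: exI[of _ "\<lambda>s. f' s + g' s"] derivative_intros)
qed (simp add: continuous_on_add)

lemma C_curve_sum:
  "(\<And>i. i \<in> I \<Longrightarrow> C_curve r S (f i)) \<Longrightarrow> C_curve r S (\<lambda>s. \<Sum>i\<in>I. f i s)"
  by (induction I rule: infinite_finite_induct) (simp_all add: C_curve_const C_curve_add)

lemma C_curve_bounded_linear:
  assumes "bounded_linear T"
  shows "C_curve r S f \<Longrightarrow> C_curve r S (\<lambda>s. T (f s))"
proof (induction r arbitrary: f)
  case 0
  then show ?case using bounded_linear.continuous_on[OF assms] by auto
next
  case (Suc r)
  then obtain f' where
    "\<forall>s\<in>S. (f has_vector_derivative f' s) (at s within S)" "C_curve r S f'" by auto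
  then show ?case using Suc.IH[of f']
    by (auto intro!: exI[of _ "\<lambda>s. T (f' s)"] bounded_linear.has_vector_derivative[OF assms])
qed

lemma C_curve_scaleR:
  "C_curve r S f \<Longrightarrow> C_curve r S g \<Longrightarrow> C_curve r S (\<lambda>s. f s *\<^sub>R g s)"
proof (induction r arbitrary: f g)
  case (Suc r)
  then obtain f' g' where d:
    "\<forall>s\<in>S. (f has_vector_derivative f' s) (at s within S)" "C_curve r S f'"
    "\<forall>s\<in>S. (g has_vector_derivative g' s) (at s within S)" "C_curve r S g'"
    by auto
  have "C_curve r S (\<lambda>s. f s *\<^sub>R g' s + f' s *\<^sub>R g s)"
    using C_curve_add[OF Suc.IH[OF C_curve_Suc_imp[OF Suc.prems(1)] d(4)]
        Suc.IH[OF d(2) C_curve_Suc_imp[OF Suc.prems(2)]]] .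
  then show ?case using d
    by (auto intro!: exI[of _ "\<lambda>s. f s *\<^sub>R g' s + f' s *\<^sub>R g s"]
        bounded_bilinear.has_vector_derivative[OF bounded_bilinear_scaleR])
qed (simp add: continuous_on_scaleR)

lemma C_class_on_Suc_imp: "C_class_on (Suc r) S f \<Longrightarrow> C_class_on r S f"
proof (induction r arbitrary: f)
  case 0
  then show ?case by (simp add: differentiable_imp_continuous_on)
next
  case (Suc r)
  have "f differentiable_on S"
    and "\<And>v. C_class_on (Suc r) S (\<lambda>x. frechet_derivative f (at x within S) v)"
    using Suc.prems by (simp_all only: C_class_on.simps(2)[of "Suc r"])
  then show ?case using Suc.IH by (simp only: C_class_on.simps(2)[of r]) blast
qed

lemma C_class_on_mono: "C_class_on r S f \<Longrightarrow> k \<le> r \<Longrightarrow> C_class_on k S f"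
proof (induction r)
  case (Suc r)
  then show ?case using C_class_on_Suc_imp[of r S f] by (cases "k = Suc r") auto
qed simp

lemma C_class_on_cong:
  assumes "\<And>x. x \<in> S \<Longrightarrow> f x = g x"
  shows "C_class_on r S f \<Longrightarrow> C_class_on r S g"
  using assms
proof (induction r arbitrary: f g)
  case 0
  then show ?case using continuous_on_cong[OF refl, of S f g] by auto
next
  case (Suc r)
  have eq: "(f has_derivative D) (at x within S) \<longleftrightarrow> (g has_derivative D) (at x within S)"
    if "x \<in> S" for x D
    using that Suc.prems(2) has_derivative_transform[of x S f g] has_derivative_transform[of x S g f]
    by auto
  then have fr: "frechet_derivative f (at x within S) v = frechet_derivative g (at x within S) v"
    if "x \<in> S" for x v using that by (simp add: frechet_derivative_def)
  have "g differentiable_on S"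
    using Suc.prems(1) eq by (auto simp: differentiable_on_def differentiable_def)
  moreover have "C_class_on r S (\<lambda>x. frechet_derivative g (at x within S) v)" for v
    by (rule Suc.IH[of "\<lambda>x. frechet_derivative f (at x within S) v"]) (use Suc.prems(1) fr in auto)
  ultimately show ?case by simp
qed

lemma C_class_on_imp_C_curve: "C_class_on r S f \<Longrightarrow> C_curve r S f"
proof (induction r arbitrary: f)
  case (Suc r)
  have "(f has_vector_derivative frechet_derivative f (at s within S) 1) (at s within S)"
    if "s \<in> S" for s
  proof -
    have "f differentiable (at s within S)"
      using Suc.prems that by (auto simp: differentiable_on_def)
    then have D: "(f has_derivative frechet_derivative f (at s within S)) (at s within S)"
      by (simp add: frechet_derivative_works)
    then have "linear (frechet_derivative f (at s within S))"
      using has_derivative_linear by blast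
    then have "frechet_derivative f (at s within S) =
        (\<lambda>x. x *\<^sub>R frechet_derivative f (at s within S) 1)"
      by (metis linear_cmul mult.right_neutral real_scaleR_def)
    then show ?thesis using D by (simp add: has_vector_derivative_def)
  qed
  then show ?case using Suc by (intro C_curve_SucI) auto
qed simp

lemma C_curve_imp_C_class_on:
  assumes "a < b"
  shows "C_curve r {a..b} f \<Longrightarrow> C_class_on r {a..b} f"
proof (induction r arbitrary: f)
  case (Suc r)
  then obtain g where g: "\<forall>s\<in>{a..b}. (f has_vector_derivative g s) (at s within {a..b})"
    "C_curve r {a..b} g" by auto
  have "frechet_derivative f (at s within {a..b}) v = v *\<^sub>R g s" if "s \<in> {a..b}" for s v
  proof -
    have D: "(f has_derivative (\<lambda>v. v *\<^sub>R g s)) (at s within {a..b})"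
      using g that by (auto simp: has_vector_derivative_def)
    then have "(f has_derivative frechet_derivative f (at s within {a..b})) (at s within {a..b})"
      using frechet_derivative_works differentiableI by blast
    then have "frechet_derivative f (at s within {a..b}) = (\<lambda>v. v *\<^sub>R g s)"
      using frechet_derivative_unique_within_closed_interval[of a b s f] D that assms by auto
    then show ?thesis by (rule fun_cong)
  qed
  moreover have "C_class_on r {a..b} (\<lambda>s. v *\<^sub>R g s)" for v
    using Suc.IH[OF C_curve_bounded_linear[OF bounded_linear_scaleR_right g(2)]] .
  ultimately have "C_class_on r {a..b} (\<lambda>s. frechet_derivative f (at s within {a..b}) v)" for v
    using C_class_on_cong[of "{a..b}" "\<lambda>s. v *\<^sub>R g s"
      "\<lambda>s. frechet_derivative f (at s within {a..b}) v" r] by simp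
  moreover have "f differentiable_on {a..b}"
    using g by (auto simp: differentiable_on_def intro: differentiableI_vector)
  ultimately show ?case by simp
qed simp

text \<open>
  Chain rule for $C^r$ maps. The derivative of \<open>G \<circ> \<gamma>\<close> is a sum, over a basis, of products of
  coordinates of $\gamma'$ with directional derivatives of \<open>G\<close> along \<open>\<gamma>\<close>, all of class $C^{r-1}$.
\<close>

lemma C_curve_compose:
  fixes G :: "'c::euclidean_space \<Rightarrow> 'd::real_normed_vector"
  assumes "\<gamma> ` S \<subseteq> T"
  shows "C_class_on r T G \<Longrightarrow> C_curve r S \<gamma> \<Longrightarrow> C_curve r S (\<lambda>s. G (\<gamma> s))"
proof (induction r arbitrary: G)
  case 0
  then show ?case using continuous_on_compose2[OF _ _ assms] by simp
next
  case (Suc r)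
  let ?D = "\<lambda>x. frechet_derivative G (at x within T)"
  obtain \<gamma>' where \<gamma>': "\<forall>s\<in>S. (\<gamma> has_vector_derivative \<gamma>' s) (at s within S)" "C_curve r S \<gamma>'"
    using Suc.prems by auto
  have D: "(G has_derivative ?D x) (at x within T)" if "x \<in> T" for x
    using Suc.prems(1) that by (auto simp: differentiable_on_def frechet_derivative_works)
  have rep: "?D (\<gamma> s) v = (\<Sum>b\<in>Basis. (v \<bullet> b) *\<^sub>R ?D (\<gamma> s) b)" if "s \<in> S" for s v
  proof -
    have l: "linear (?D (\<gamma> s))" using D that assms has_derivative_linear by blast
    have "?D (\<gamma> s) (\<Sum>b\<in>Basis. (v \<bullet> b) *\<^sub>R b) = (\<Sum>b\<in>Basis. (v \<bullet> b) *\<^sub>R ?D (\<gamma> s) b)"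
      by (simp add: linear_sum[OF l] linear_cmul[OF l])
    then show ?thesis by (simp add: euclidean_representation)
  qed
  have "((\<lambda>s. G (\<gamma> s)) has_vector_derivative ?D (\<gamma> s) (\<gamma>' s)) (at s within S)" if s: "s \<in> S" for s
  proof -
    have l: "linear (?D (\<gamma> s))" using D that assms has_derivative_linear by blast
    have "((\<lambda>s. G (\<gamma> s)) has_derivative (\<lambda>v. ?D (\<gamma> s) (v *\<^sub>R \<gamma>' s))) (at s within S)"
      using has_derivative_in_compose2[OF D assms s] \<gamma>' s
      by (auto simp: has_vector_derivative_def)
    then show ?thesis by (simp add: has_vector_derivative_def linear_cmul[OF l])
  qed
  moreover have "C_curve r S (\<lambda>s. ?D (\<gamma> s) (\<gamma>' s))"
  proof (rule C_curve_cong)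
    show "C_curve r S (\<lambda>s. \<Sum>b\<in>Basis. (\<gamma>' s \<bullet> b) *\<^sub>R ?D (\<gamma> s) b)"
      using Suc \<gamma>' C_curve_Suc_imp[of r S \<gamma>]
      by (intro C_curve_sum C_curve_scaleR C_curve_bounded_linear[OF bounded_linear_inner_left]) auto
  qed (rule rep[symmetric])
  ultimately show ?case by (rule C_curve_SucI)
qed

lemma C_curve_nth_deriv:
  assumes "a < b" "C_curve r {a..b} f"
  shows "i \<le> r \<Longrightarrow> C_curve (r - i) {a..b} (nth_deriv {a..b} i f)"
proof (induction i)
  case (Suc i)
  then have "C_curve (Suc (r - Suc i)) {a..b} (nth_deriv {a..b} i f)"
    using Suc_diff_Suc[of i r] by auto
  then obtain g where "\<forall>s\<in>{a..b}. (nth_deriv {a..b} i f has_vector_derivative g s) (at s within {a..b})"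
    "C_curve (r - Suc i) {a..b} g" by auto
  then have "vector_derivative (nth_deriv {a..b} i f) (at s within {a..b}) = g s"
    if "s \<in> {a..b}" for s
    using that vector_derivative_within_cbox[OF assms(1), of s "nth_deriv {a..b} i f" "g s"] by simp
  then show ?case
    using \<open>C_curve (r - Suc i) {a..b} g\<close>
      C_curve_cong[of "{a..b}" g "nth_deriv {a..b} (Suc i) f"] by simp
qed (use assms in simp)

lemma nth_deriv_has_vector_derivative:
  assumes "a < b" "C_curve r {a..b} f" "i < r" "s \<in> {a..b}"
  shows "(nth_deriv {a..b} i f has_vector_derivative nth_deriv {a..b} (Suc i) f s) (at s within {a..b})"
proof -
  have "C_curve (Suc (r - Suc i)) {a..b} (nth_deriv {a..b} i f)"
    using C_curve_nth_deriv[of a b r f i] assms Suc_diff_Suc[of i r] by auto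
  then have "nth_deriv {a..b} i f differentiable (at s within {a..b})"
    using assms(4) by (auto intro: differentiableI_vector)
  then show ?thesis by (simp add: vector_derivative_works)
qed

text \<open>
  Derivatives of a curve that vanishes on a closed subinterval vanish there too, endpoints included,
  as the derivative within the subinterval is already unique.
\<close>

lemma nth_deriv_eq_0:
  assumes "a < b" "C_curve r {a..b} f" "a \<le> c" "c < d" "d \<le> b" "\<And>s. s \<in> {c..d} \<Longrightarrow> f s = 0"
  shows "i \<le> r \<Longrightarrow> s \<in> {c..d} \<Longrightarrow> nth_deriv {a..b} i f s = 0"
proof (induction i arbitrary: s)
  case (Suc i)
  have "(nth_deriv {a..b} i f has_vector_derivative nth_deriv {a..b} (Suc i) f s) (at s within {c..d})"
    using nth_deriv_has_vector_derivative[OF assms(1,2), of i s] Suc.prems assms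
    by (auto intro: has_vector_derivative_within_subset)
  moreover have "((\<lambda>_. 0) has_vector_derivative nth_deriv {a..b} (Suc i) f s) (at s within {c..d})"
    by (rule has_vector_derivative_transform[of s _ _ "nth_deriv {a..b} i f"])
      (use Suc calculation in auto)
  ultimately show ?case
    using vector_derivative_unique_within_closed_interval[OF \<open>c < d\<close>, of s "\<lambda>_. 0" "nth_deriv {a..b} (Suc i) f s" 0]
      Suc.prems by auto
qed (use assms in simp)

text \<open>
  The product of two truncated powers, with \<open>k = 1\<close> and \<open>k = -1\<close>, is a bump function of any prescribed
  finite smoothness that is positive exactly on an open interval.
\<close>

lemma C_curve_truncated_power:
  fixes k c :: real
  shows "C_curve r S (\<lambda>s. max 0 (k * (s - c)) ^ Suc r)"
proof (induction r)
  case 0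
  then show ?case by (auto intro!: continuous_intros)
next
  case (Suc r)
  let ?g = "\<lambda>s. (k * (real r + 2)) *\<^sub>R max 0 (k * (s - c)) ^ Suc r"
  have max: "((\<lambda>x::real. max 0 x ^ Suc (Suc r)) has_real_derivative (real r + 2) * max 0 x ^ Suc r) (at x)" for x :: real
  proof -
    consider "x < 0" | "x = 0" | "x > 0" by linarith
    then show ?thesis
    proof cases
      case 1
      have "((\<lambda>x::real. 0) has_real_derivative (real r + 2) * max 0 x ^ Suc r) (at x)" using 1 by auto
      then show ?thesis
        by (rule has_field_derivative_transform_within[where d = "-x"]) (use 1 in \<open>auto simp: dist_real_def\<close>)
    next
      \<comment> \<open>Caratheodory's criterion, with the factorization \<open>max 0 z ^ (r + 2) = max 0 z ^ (r + 1) * z\<close>.\<close>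
      case 2
      then show ?thesis
        by (auto simp: CARAT_DERIV max_def intro!: exI[of _ "\<lambda>z. max 0 z ^ Suc r"] continuous_intros)
    next
      case 3
      have "((\<lambda>x::real. x ^ Suc (Suc r)) has_real_derivative (real r + 2) * max 0 x ^ Suc r) (at x)"
        using 3 DERIV_pow[of "Suc (Suc r)" x UNIV] by (simp add: add.commute)
      then show ?thesis
        by (rule has_field_derivative_transform_within[where d = "x"]) (use 3 in \<open>auto simp: dist_real_def\<close>)
    qed
  qed
  have "((\<lambda>s. max 0 (k * (s - c)) ^ Suc (Suc r)) has_vector_derivative ?g s) (at s within S)" for s
  proof -
    have "((\<lambda>s. k * (s - c)) has_real_derivative k) (at s within S)"
      by (auto intro!: derivative_eq_intros)
    from DERIV_chain2[OF max this] show ?thesis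
      by (simp add: has_real_derivative_iff_has_vector_derivative mult_ac)
  qed
  moreover have "C_curve r S ?g"
    using Suc.IH by (intro C_curve_bounded_linear[OF bounded_linear_scaleR_right])
  ultimately show ?case by (rule C_curve_SucI)
qed

section \<open>Leibniz' rule\<close>

text \<open>
  The step $j \to j + 1$ of Leibniz' rule: \<open>G l k\<close> stands for the product of the \<open>l\<close>-th derivative
  of one factor with the \<open>k\<close>-th derivative of the other one.
\<close>

lemma sum_binomial_Pascal:
  fixes G :: "nat \<Rightarrow> nat \<Rightarrow> 'v::real_vector"
  shows "(\<Sum>l\<le>Suc j. real (Suc j choose l) *\<^sub>R G l (Suc j - l)) =
     (\<Sum>l\<le>j. real (j choose l) *\<^sub>R (G l (Suc (j - l)) + G (Suc l) (j - l)))"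
proof -
  have "(\<Sum>l\<le>Suc j. real (j choose l) *\<^sub>R G l (Suc j - l)) =
      G 0 (Suc j) + (\<Sum>l\<le>j. real (j choose Suc l) *\<^sub>R G (Suc l) (j - l))"
    by (subst sum.atMost_Suc_shift) simp
  moreover have "(\<Sum>l\<le>Suc j. real (j choose l) *\<^sub>R G l (Suc j - l)) =
      (\<Sum>l\<le>j. real (j choose l) *\<^sub>R G l (Suc (j - l)))"
    by (simp add: Suc_diff_le)
  ultimately show ?thesis
    by (subst sum.atMost_Suc_shift) (simp add: algebra_simps sum.distrib)
qed

lemma Leibniz_has_vector_derivative:
  fixes W :: "nat \<Rightarrow> real \<Rightarrow> real" and f :: "nat \<Rightarrow> real \<Rightarrow> 'v::real_normed_vector"
  assumes "\<And>l. l \<le> j \<Longrightarrow> (W l has_real_derivative W (Suc l) s) (at s within S)"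
    and "\<And>l. l \<le> j \<Longrightarrow> (f l has_vector_derivative f (Suc l) s) (at s within S)"
  shows "((\<lambda>s. \<Sum>l\<le>j. real (j choose l) *\<^sub>R (W l s *\<^sub>R f (j - l) s)) has_vector_derivative
     (\<Sum>l\<le>Suc j. real (Suc j choose l) *\<^sub>R (W l s *\<^sub>R f (Suc j - l) s))) (at s within S)"
proof -
  have "((\<lambda>s. W l s *\<^sub>R f (j - l) s) has_vector_derivative
      W l s *\<^sub>R f (Suc (j - l)) s + W (Suc l) s *\<^sub>R f (j - l) s) (at s within S)" if "l \<le> j" for l
    using assms that by (intro has_vector_derivative_scaleR) auto
  then show ?thesis
    by (subst sum_binomial_Pascal[of j "\<lambda>l k. W l s *\<^sub>R f k s"])
      (intro has_vector_derivative_sum bounded_linear.has_vector_derivative[OF bounded_linear_scaleR_right], auto)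
qed

section \<open>Integration by parts and the Euler-Lagrange equation\<close>

text \<open>
  Summation by parts. Here \<open>P i j\<close> is the \<open>j\<close>-th derivative of the coefficient of the \<open>i\<close>-th derivative
  of \<open>h\<close>, and the inner sums $\Psi^j$ satisfy $(\Psi^j)' = P_{j-1} - \Psi^{j-1}$, so the derivative of
  $\sum_j \Psi^j \cdot h^{(j-1)}$ telescopes.
\<close>

lemma momentum_derivative:
  fixes P :: "nat \<Rightarrow> nat \<Rightarrow> real \<Rightarrow> 'v::real_inner" and h :: "nat \<Rightarrow> real \<Rightarrow> 'v"
  assumes P: "\<And>i j. j < i \<Longrightarrow> i \<le> m \<Longrightarrow> (P i j has_vector_derivative P i (Suc j) s) (at s within S)"
    and h: "\<And>j. j < m \<Longrightarrow> (h j has_vector_derivative h (Suc j) s) (at s within S)"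
  shows "((\<lambda>s. \<Sum>j=1..m. (\<Sum>i=0..m-j. (-1) ^ i *\<^sub>R P (i + j) i s) \<bullet> h (j - 1) s)
     has_vector_derivative
       (\<Sum>i=0..m. P i 0 s \<bullet> h i s) - (\<Sum>i=0..m. (-1) ^ i *\<^sub>R P i i s) \<bullet> h 0 s) (at s within S)"
proof -
  define M where "M j s = (\<Sum>i=0..m-j. (-1) ^ i *\<^sub>R P (i + j) i s)" for j s
  have M: "(M j has_vector_derivative P (j - 1) 0 s - M (j - 1) s) (at s within S)"
    if j: "j \<in> {1..m}" for j
  proof -
    have "(M j has_vector_derivative (\<Sum>i=0..m-j. (-1) ^ i *\<^sub>R P (i + j) (Suc i) s)) (at s within S)"
      unfolding M_def using j
      by (intro has_vector_derivative_sum bounded_linear.has_vector_derivative[OF bounded_linear_scaleR_right] P) auto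
    moreover have "M (j - 1) s = P (j - 1) 0 s - (\<Sum>i=0..m-j. (-1) ^ i *\<^sub>R P (i + j) (Suc i) s)"
    proof -
      have "m - (j - 1) = Suc (m - j)" using j by auto
      then have "M (j - 1) s = P (j - 1) 0 s +
          (\<Sum>i=0..m-j. (-1) ^ Suc i *\<^sub>R P (i + j) (Suc i) s)"
        unfolding M_def using j
        by (subst \<open>m - (j - 1) = _\<close>, subst sum.atLeast0_atMost_Suc_shift) simp
      then show ?thesis by (simp add: sum_negf)
    qed
    ultimately show ?thesis by simp
  qed
  have tel: "(\<Sum>j=1..n. M j s \<bullet> h j s + (P (j - 1) 0 s - M (j - 1) s) \<bullet> h (j - 1) s) =
      M n s \<bullet> h n s - M 0 s \<bullet> h 0 s + (\<Sum>i<n. P i 0 s \<bullet> h i s)" for n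
    by (induction n) (auto simp: algebra_simps)
  have "((\<lambda>s. \<Sum>j=1..m. M j s \<bullet> h (j - 1) s) has_vector_derivative
      (\<Sum>j=1..m. M j s \<bullet> h j s + (P (j - 1) 0 s - M (j - 1) s) \<bullet> h (j - 1) s)) (at s within S)"
  proof (intro has_vector_derivative_sum)
    fix j assume j: "j \<in> {1..m}"
    have "(h (j - 1) has_vector_derivative h j s) (at s within S)" using h[of "j - 1"] j by auto
    from bounded_bilinear.has_vector_derivative[OF bounded_bilinear_inner M[OF j] this]
    show "((\<lambda>s. M j s \<bullet> h (j - 1) s) has_vector_derivative
        M j s \<bullet> h j s + (P (j - 1) 0 s - M (j - 1) s) \<bullet> h (j - 1) s) (at s within S)" .
  qed
  moreover have "M m s \<bullet> h m s - M 0 s \<bullet> h 0 s + (\<Sum>i<m. P i 0 s \<bullet> h i s) =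
      (\<Sum>i=0..m. P i 0 s \<bullet> h i s) - (\<Sum>i=0..m. (-1) ^ i *\<^sub>R P i i s) \<bullet> h 0 s"
  proof -
    have "{0..m} = insert m {..<m}" by auto
    then show ?thesis by (simp add: M_def)
  qed
  ultimately show ?thesis unfolding tel by (simp only: M_def[symmetric])
qed

text \<open>
  Test curves of class $C^N$ vanishing to order \<open>N\<close> at \<open>a\<close> suffice for the Euler-Lagrange equation, which
  holds up to the endpoint \<open>a\<close> itself. Nothing is required of the coefficients at \<open>t\<close>, where the fractional
  weight may be singular.
\<close>

lemma higher_order_Euler_Lagrange:
  fixes P :: "nat \<Rightarrow> nat \<Rightarrow> real \<Rightarrow> 'v::euclidean_space"
  assumes "a < t" "t \<le> b" "m \<le> N"
    and P: "\<And>i j s. j < i \<Longrightarrow> i \<le> m \<Longrightarrow> s \<in> {a..<t} \<Longrightarrow>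
        (P i j has_vector_derivative P i (Suc j) s) (at s within {a..<t})"
    and cont: "\<And>i. i \<le> m \<Longrightarrow> continuous_on {a..<t} (P i i)"
    and stationary: "\<And>h. C_curve N {a..b} h \<Longrightarrow> (\<And>i. i \<le> N \<Longrightarrow> nth_deriv {a..b} i h a = 0) \<Longrightarrow>
        integral {a..t} (\<lambda>s. \<Sum>i=0..m. P i 0 s \<bullet> nth_deriv {a..b} i h s) = 0"
    and s0: "s0 \<in> {a..<t}"
  shows "(\<Sum>i=0..m. (-1) ^ i *\<^sub>R P i i s0) = 0"
proof (rule ccontr)
  define E where "E s = (\<Sum>i=0..m. (-1) ^ i *\<^sub>R P i i s)" for s
  assume "(\<Sum>i=0..m. (-1) ^ i *\<^sub>R P i i s0) \<noteq> 0"
  then have E0: "E s0 \<bullet> E s0 > 0" by (simp add: E_def)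
  have contE: "continuous_on {a..<t} E"
    unfolding E_def using cont by (intro continuous_intros) auto
  then have "continuous_on {a..<t} (\<lambda>s. E s \<bullet> E s0)"
    by (intro continuous_intros)
  then have "((\<lambda>s. E s \<bullet> E s0) \<longlongrightarrow> E s0 \<bullet> E s0) (at s0 within {a..<t})"
    using s0 by (auto simp: continuous_on_def)
  then have "eventually (\<lambda>s. E s \<bullet> E s0 > 0) (at s0 within {a..<t})"
    using E0 by (rule order_tendstoD)
  then obtain \<delta> where "\<delta> > 0" and \<delta>: "\<And>s. s \<in> {a..<t} \<Longrightarrow> s \<noteq> s0 \<Longrightarrow> dist s s0 < \<delta> \<Longrightarrow> E s \<bullet> E s0 > 0"
    unfolding eventually_at by auto
  \<comment> \<open>The support \<open>{c..d}\<close> of the test curve lies strictly to the right of \<open>s0\<close>, so that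
    the case \<open>s0 = a\<close> needs no separate treatment.\<close>
  define \<eta> where "\<eta> = min \<delta> (t - s0)"
  define c d where "c = s0 + \<eta> / 3" and "d = s0 + 2 * \<eta> / 3"
  have \<eta>: "\<eta> > 0" "\<eta> \<le> \<delta>" "\<eta> \<le> t - s0" using \<open>\<delta> > 0\<close> s0 by (auto simp: \<eta>_def)
  have cd: "a < c" "c < d" "d < t" "a < b" using \<eta> s0 assms(1,2) by (auto simp: c_def d_def)
  have pos: "E s \<bullet> E s0 > 0" if "s \<in> {c..d}" for s
    using \<delta>[of s] that \<eta> s0 by (auto simp: c_def d_def dist_real_def)
  define \<phi> where "\<phi> s = max 0 (1 * (s - c)) ^ Suc N * max 0 ((-1) * (s - d)) ^ Suc N" for s :: real
  define h where "h s = \<phi> s *\<^sub>R E s0" for s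
  have "C_curve N {a..b} \<phi>"
    using C_curve_scaleR[OF C_curve_truncated_power[of N "{a..b}" 1 c] C_curve_truncated_power[of N "{a..b}" "-1" d]]
    unfolding \<phi>_def real_scaleR_def by simp
  then have hC: "C_curve N {a..b} h"
    unfolding h_def by (intro C_curve_scaleR C_curve_const)
  have h0: "nth_deriv {a..b} i h s = 0" if "i \<le> N" "s \<in> {a..b}" "s \<notin> {c<..<d}" for i s
  proof (cases "s \<le> c")
    case True
    show ?thesis
      by (rule nth_deriv_eq_0[OF \<open>a < b\<close> hC, of a c])
        (use cd True that assms(2) in \<open>auto simp: h_def \<phi>_def\<close>)
  next
    case False
    show ?thesis
      by (rule nth_deriv_eq_0[OF \<open>a < b\<close> hC, of d b])
        (use cd False that assms(2) in \<open>auto simp: h_def \<phi>_def\<close>)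
  qed
  let ?I = "\<lambda>s. \<Sum>i=0..m. P i 0 s \<bullet> nth_deriv {a..b} i h s"
  let ?B = "\<lambda>s. \<Sum>j=1..m. (\<Sum>i=0..m-j. (-1) ^ i *\<^sub>R P (i + j) i s) \<bullet> nth_deriv {a..b} (j - 1) h s"
  have sub: "{c..d} \<subseteq> {a..<t}" "{c..d} \<subseteq> {a..b}" using cd assms(2) by auto
  \<comment> \<open>The boundary terms vanish because all derivatives of \<open>h\<close> up to order \<open>N\<close> vanish at \<open>c\<close> and \<open>d\<close>.\<close>
  have "((\<lambda>s. ?I s - E s \<bullet> h s) has_integral (?B d - ?B c)) {c..d}"
  proof (rule fundamental_theorem_of_calculus)
    fix s assume s: "s \<in> {c..d}"
    have "(?B has_vector_derivative ?I s - (\<Sum>i=0..m. (-1) ^ i *\<^sub>R P i i s) \<bullet> nth_deriv {a..b} 0 h s) (at s within {c..d})"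
    proof (rule momentum_derivative)
      fix i j assume "j < i" "i \<le> m"
      then show "(P i j has_vector_derivative P i (Suc j) s) (at s within {c..d})"
        using P s sub by (blast intro: has_vector_derivative_within_subset)
    next
      fix j assume "j < m"
      then show "(nth_deriv {a..b} j h has_vector_derivative nth_deriv {a..b} (Suc j) h s) (at s within {c..d})"
        using nth_deriv_has_vector_derivative[OF \<open>a < b\<close> hC, of j s] s sub assms(3)
        by (auto intro: has_vector_derivative_within_subset)
    qed
    then show "(?B has_vector_derivative ?I s - E s \<bullet> h s) (at s within {c..d})"
      by (simp add: E_def)
  qed (use cd in simp)
  moreover have "?B c = 0" "?B d = 0"
    using h0 cd assms(2,3) by (auto intro!: sum.neutral)
  moreover have contEh: "continuous_on {c..d} (\<lambda>s. E s \<bullet> h s)"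
    using continuous_on_subset[OF contE sub(1)] continuous_on_subset[OF C_curve_imp_continuous_on[OF hC] sub(2)]
    by (intro continuous_intros)
  ultimately have "(?I has_integral integral {c..d} (\<lambda>s. E s \<bullet> h s)) {c..d}"
    using has_integral_add[of "\<lambda>s. ?I s - E s \<bullet> h s" 0 "{c..d}" "\<lambda>s. E s \<bullet> h s"]
      integrable_integral[OF integrable_continuous_interval[OF contEh]] by fastforce
  moreover have "?I s = 0" if "s \<in> {a..t} - {c..d}" for s
    using that h0 assms(2,3) by (auto intro!: sum.neutral)
  ultimately have "(?I has_integral integral {c..d} (\<lambda>s. E s \<bullet> h s)) {a..t}"
    using has_integral_restrict[of "{c..d}" "{a..t}" ?I] cd
      has_integral_eq[of "{a..t}" "\<lambda>s. if s \<in> {c..d} then ?I s else 0" ?I]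
    by auto
  then have "integral {c..d} (\<lambda>s. E s \<bullet> h s) = 0"
    using stationary[OF hC] h0 cd assms(2) by (simp add: integral_unique)
  moreover have nonneg: "E s \<bullet> h s \<ge> 0" if "s \<in> {c..d}" for s
    using pos[OF that] by (simp add: h_def \<phi>_def)
  ultimately have "E ((c + d) / 2) \<bullet> h ((c + d) / 2) = 0"
    using integral_eq_0_iff[OF contEh \<open>c < d\<close> nonneg] cd by auto
  moreover have "E ((c + d) / 2) \<bullet> h ((c + d) / 2) > 0"
    using pos[of "(c + d) / 2"] cd by (auto simp: h_def \<phi>_def intro!: mult_pos_pos)
  ultimately show False by simp
qed

section \<open>The Lagrangian along the jet of a curve\<close>

lemma pd_slot_eq_frechet_derivative:
  fixes L :: "real \<times> ((real^'n)^'k) \<Rightarrow> real"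
  assumes L: "L differentiable_on S \<times> UNIV" and z: "z \<in> S \<times> UNIV"
  shows "pd_slot L k z $ j = frechet_derivative L (at z within S \<times> UNIV) (0, axis k (axis j 1))"
proof -
  obtain \<theta> x where [simp]: "z = (\<theta>, x)" by (cases z)
  let ?v = "axis k (axis j 1) :: (real^'n)^'k"
  let ?D = "\<lambda>z. frechet_derivative L (at z within S \<times> UNIV)"
  have D: "(L has_derivative ?D z) (at z within S \<times> UNIV)" if "z \<in> S \<times> UNIV" for z
    using L that by (auto simp: differentiable_on_def frechet_derivative_works)
  have lin: "linear (?D z)" using D[OF z] has_derivative_linear by blast
  have "((\<lambda>s::real. (\<theta>, x + s *\<^sub>R ?v)) has_derivative (\<lambda>s. (0, s *\<^sub>R ?v))) (at 0)"
    by (auto intro!: derivative_eq_intros)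
  moreover have "range (\<lambda>s::real. (\<theta>, x + s *\<^sub>R ?v)) \<subseteq> S \<times> UNIV" using z by auto
  ultimately have "((\<lambda>s. L (\<theta>, x + s *\<^sub>R ?v)) has_derivative (\<lambda>s. ?D z (0, s *\<^sub>R ?v))) (at 0)"
    using has_derivative_in_compose2[OF D, of "\<lambda>s::real. (\<theta>, x + s *\<^sub>R ?v)" UNIV 0] by simp
  moreover have "?D z (0, s *\<^sub>R ?v) = ?D z (0, ?v) * s" for s
    using linear_cmul[OF lin, of s "(0, ?v)"] by simp
  ultimately have "((\<lambda>s. L (\<theta>, x + s *\<^sub>R ?v)) has_field_derivative ?D z (0, ?v)) (at 0)"
    by (simp add: has_field_derivative_def)
  then show ?thesis by (simp add: pd_slot_def DERIV_imp_deriv)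
qed

lemma pd_time_eq_frechet_derivative:
  fixes L :: "real \<times> ((real^'n)^'k) \<Rightarrow> real"
  assumes L: "L differentiable_on {a..b} \<times> UNIV" and z: "z \<in> {a..b} \<times> UNIV" and "a < b"
  shows "pd_time {a..b} L z = frechet_derivative L (at z within {a..b} \<times> UNIV) (1, 0)"
proof -
  obtain \<theta> x where [simp]: "z = (\<theta>, x)" by (cases z)
  let ?D = "\<lambda>z. frechet_derivative L (at z within {a..b} \<times> UNIV)"
  have D: "(L has_derivative ?D z) (at z within {a..b} \<times> UNIV)" if "z \<in> {a..b} \<times> UNIV" for z
    using L that by (auto simp: differentiable_on_def frechet_derivative_works)
  have lin: "linear (?D z)" using D[OF z] has_derivative_linear by blast
  have "((\<lambda>s. (s, x)) has_derivative (\<lambda>s. (s, 0))) (at \<theta> within {a..b})"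
    by (auto intro!: derivative_eq_intros)
  moreover have "(\<lambda>s. (s, x)) ` {a..b} \<subseteq> {a..b} \<times> UNIV" by auto
  ultimately have "((\<lambda>s. L (s, x)) has_derivative (\<lambda>s. ?D z (s, 0))) (at \<theta> within {a..b})"
    using has_derivative_in_compose2[OF D, of "\<lambda>s. (s, x)" "{a..b}" \<theta>] z by simp
  moreover have "?D z (s, 0) = s *\<^sub>R ?D z (1, 0)" for s
    using linear_cmul[OF lin, of s "(1, 0)"] by simp
  ultimately have "((\<lambda>s. L (s, x)) has_vector_derivative ?D z (1, 0)) (at \<theta> within {a..b})"
    unfolding has_vector_derivative_def by (elim has_derivative_eq_rhs) (rule ext)
  from vector_derivative_within_closed_interval[OF \<open>a < b\<close> _ this] z show ?thesis
    by (simp add: pd_time_def)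
qed

lemma frechet_derivative_Lagrangian:
  fixes L :: "real \<times> ((real^'n)^'k) \<Rightarrow> real"
  assumes L: "L differentiable_on {a..b} \<times> UNIV" and z: "z \<in> {a..b} \<times> UNIV" and "a < b"
  shows "frechet_derivative L (at z within {a..b} \<times> UNIV) (1, y) =
     pd_time {a..b} L z + (\<Sum>k\<in>UNIV. pd_slot L k z \<bullet> y $ k)"
proof -
  let ?D = "frechet_derivative L (at z within {a..b} \<times> UNIV)"
  have "(L has_derivative ?D) (at z within {a..b} \<times> UNIV)"
    using L z by (auto simp: differentiable_on_def frechet_derivative_works)
  then have lin: "linear ?D" using has_derivative_linear by blast
  have delta: "(\<Sum>j\<in>UNIV. if k = l then if i = j then f j else 0 else 0) = (if k = l then f i else 0)"
    for k l :: 'k and i :: 'n and f :: "'n \<Rightarrow> real" by simp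
  have "y = (\<Sum>k\<in>UNIV. \<Sum>j\<in>UNIV. (y $ k $ j) *\<^sub>R axis k (axis j 1))"
    by (simp add: vec_eq_iff sum_component axis_def if_distrib[of "\<lambda>x. x $ _"]
        if_distrib[of "\<lambda>x. _ * x"] delta cong: if_cong)
  then have "(0::real, y) = (0, \<Sum>k\<in>UNIV. \<Sum>j\<in>UNIV. (y $ k $ j) *\<^sub>R axis k (axis j 1))"
    by (rule arg_cong)
  also have "\<dots> = (\<Sum>k\<in>UNIV. \<Sum>j\<in>UNIV. (y $ k $ j) *\<^sub>R (0, axis k (axis j 1)))"
    by (simp add: prod_eq_iff fst_sum snd_sum)
  finally have "?D (0, y) = ?D (\<Sum>k\<in>UNIV. \<Sum>j\<in>UNIV. (y $ k $ j) *\<^sub>R (0, axis k (axis j 1)))"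
    by (rule arg_cong)
  also have "\<dots> = (\<Sum>k\<in>UNIV. \<Sum>j\<in>UNIV. (y $ k $ j) *\<^sub>R ?D (0, axis k (axis j 1)))"
    by (simp only: linear_sum[OF lin] linear_cmul[OF lin])
  also have "\<dots> = (\<Sum>k\<in>UNIV. pd_slot L k z \<bullet> y $ k)"
    by (simp add: inner_vec_def pd_slot_eq_frechet_derivative[OF L z] mult.commute)
  finally have "?D (0, y) = (\<Sum>k\<in>UNIV. pd_slot L k z \<bullet> y $ k)" .
  moreover have "?D (1, y) = ?D (1, 0) + ?D (0, y)"
    using linear_add[OF lin, of "(1, 0)" "(0, y)"] by simp
  ultimately show ?thesis by (simp add: pd_time_eq_frechet_derivative[OF assms])
qed

lemma C_curve_pd_slot:
  fixes L :: "real \<times> ((real^'n)^'k) \<Rightarrow> real"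
  assumes L: "C_class_on (Suc r) (S \<times> UNIV) L" and "C_curve r S \<gamma>" and im: "\<gamma> ` S \<subseteq> S \<times> UNIV"
  shows "C_curve r S (\<lambda>s. pd_slot L k (\<gamma> s))"
proof (rule C_curve_cong)
  let ?D = "\<lambda>z. frechet_derivative L (at z within S \<times> UNIV)"
  show "C_curve r S (\<lambda>s. \<Sum>j\<in>UNIV. ?D (\<gamma> s) (0, axis k (axis j 1)) *\<^sub>R axis j 1)"
  proof (intro C_curve_sum C_curve_scaleR C_curve_const)
    fix j
    show "C_curve r S (\<lambda>s. ?D (\<gamma> s) (0, axis k (axis j 1)))"
      using C_curve_compose[OF im _ assms(2), of "\<lambda>z. ?D z (0, axis k (axis j 1))"] L by simp
  qed
  have expansion: "(\<Sum>j\<in>UNIV. c j *\<^sub>R axis j 1) = (\<chi> j. c j)" for c :: "'n \<Rightarrow> real"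
    by (simp add: vec_eq_iff sum_component axis_def if_distrib[of "\<lambda>x. _ * x"] cong: if_cong)
  fix s assume "s \<in> S"
  then have z: "\<gamma> s \<in> S \<times> UNIV" using im by auto
  have "L differentiable_on S \<times> UNIV" using L by simp
  from pd_slot_eq_frechet_derivative[OF this z] show "(\<Sum>j\<in>UNIV. ?D (\<gamma> s) (0, axis k (axis j 1)) *\<^sub>R axis j 1) = pd_slot L k (\<gamma> s)"
    by (simp add: expansion vec_eq_iff)
qed

lemma bounded_linear_Pair_axis: "bounded_linear (\<lambda>x::real^'n. (0::real, axis k x :: (real^'n)^'k))"
  unfolding linear_conv_bounded_linear[symmetric]
  by (rule linearI) (auto simp: vec_eq_iff axis_def)

text \<open>
  The jet is a sum of bounded linear images of the time and of derivatives of \<open>q\<close>, from which its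
  smoothness and its derivative can be read off.
\<close>

lemma jet_eq_sum:
  "jet e m S q = (\<lambda>s. s *\<^sub>R (1, 0) + (\<Sum>k\<in>UNIV. (0, axis k (nth_deriv S (the_inv_into {0..m} e k) q s))))"
  by (rule ext) (simp add: jet_def prod_eq_iff fst_sum snd_sum vec_eq_iff sum_component axis_def)

lemma the_inv_into_slot_le: 
  assumes "bij_betw e {0..m} UNIV" 
  shows "the_inv_into {0..m} e k \<le> m"
  using bij_betw_the_inv_into[OF assms] by (auto simp: bij_betw_def)

lemma C_curve_jet:
  assumes "a < b" "bij_betw e {0..m} UNIV" "C_curve (2 * m) {a..b} q"
  shows "C_curve m {a..b} (jet e m {a..b} q)"
  unfolding jet_eq_sum
proof (intro C_curve_add C_curve_sum C_curve_scaleR C_curve_const C_curve_ident)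
  fix k
  let ?i = "the_inv_into {0..m} e k"
  have "C_curve (2 * m - ?i) {a..b} (nth_deriv {a..b} ?i q)"
    using the_inv_into_slot_le[OF assms(2), of k] by (intro C_curve_nth_deriv assms) auto
  then have "C_curve m {a..b} (nth_deriv {a..b} ?i q)"
    by (rule C_curve_mono) (use the_inv_into_slot_le[OF assms(2), of k] in auto)
  then show "C_curve m {a..b} (\<lambda>s. (0::real, axis k (nth_deriv {a..b} ?i q s)))"
    by (rule C_curve_bounded_linear[OF bounded_linear_Pair_axis])
qed

lemma jet_has_vector_derivative:
  assumes "a < b" "bij_betw e {0..m} UNIV" "C_curve r {a..b} q" "m < r" "\<theta> \<in> {a..b}"
  shows "(jet e m {a..b} q has_vector_derivative
     (1, \<chi> k. nth_deriv {a..b} (Suc (the_inv_into {0..m} e k)) q \<theta>)) (at \<theta> within {a..b})"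
proof -
  let ?i = "the_inv_into {0..m} e"
  have "(jet e m {a..b} q has_vector_derivative
     1 *\<^sub>R (1, 0) + (\<Sum>k\<in>UNIV. (0, axis k (nth_deriv {a..b} (Suc (?i k)) q \<theta>)))) (at \<theta> within {a..b})"
    unfolding jet_eq_sum
  proof (intro has_vector_derivative_add has_vector_derivative_sum
      bounded_linear.has_vector_derivative[OF bounded_linear_Pair_axis]
      bounded_linear.has_vector_derivative[OF bounded_linear_scaleR_left] has_vector_derivative_id)
    show "(nth_deriv {a..b} (?i k) q has_vector_derivative nth_deriv {a..b} (Suc (?i k)) q \<theta>)
        (at \<theta> within {a..b})" for k
      using the_inv_into_slot_le[OF assms(2), of k] assms
      by (intro nth_deriv_has_vector_derivative[of a b r]) auto
  qed
  moreover have "1 *\<^sub>R (1, 0) + (\<Sum>k\<in>UNIV. (0, axis k (nth_deriv {a..b} (Suc (?i k)) q \<theta>))) =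
      (1::real, \<chi> k. nth_deriv {a..b} (Suc (?i k)) q \<theta>)"
    by (simp add: prod_eq_iff fst_sum snd_sum vec_eq_iff sum_component axis_def)
  ultimately show ?thesis by simp
qed

lemma Lagrangian_along_jet_derivative:
  fixes L :: "real \<times> ((real^'n)^'k) \<Rightarrow> real"
  assumes "a < b" and e: "bij_betw e {0..m} UNIV" and "C_curve r {a..b} q" "m < r"
    and L: "L differentiable_on {a..b} \<times> UNIV" and \<theta>: "\<theta> \<in> {a..b}"
  shows "((\<lambda>s. L (jet e m {a..b} q s)) has_vector_derivative
     pd_time {a..b} L (jet e m {a..b} q \<theta>) +
     (\<Sum>i=0..m. pd_slot L (e i) (jet e m {a..b} q \<theta>) \<bullet> nth_deriv {a..b} (Suc i) q \<theta>)) (at \<theta> within {a..b})"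
proof -
  let ?\<gamma> = "jet e m {a..b} q" and ?T = "{a..b} \<times> (UNIV :: ((real^'n)^'k) set)"
  let ?D = "\<lambda>z. frechet_derivative L (at z within ?T)"
  let ?y = "\<chi> k. nth_deriv {a..b} (Suc (the_inv_into {0..m} e k)) q \<theta>"
  have im: "?\<gamma> ` {a..b} \<subseteq> ?T" by (auto simp: jet_def)
  have D: "(L has_derivative ?D z) (at z within ?T)" if "z \<in> ?T" for z
    using L that by (auto simp: differentiable_on_def frechet_derivative_works)
  have z: "?\<gamma> \<theta> \<in> ?T" using im \<theta> by blast
  have lin: "linear (?D (?\<gamma> \<theta>))" using D[OF z] has_derivative_linear by blast
  have "((\<lambda>s. L (?\<gamma> s)) has_derivative (\<lambda>v. ?D (?\<gamma> \<theta>) (v *\<^sub>R (1, ?y)))) (at \<theta> within {a..b})"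
    using has_derivative_in_compose2[OF D im \<theta>]
      jet_has_vector_derivative[OF assms(1-4) \<theta>, unfolded has_vector_derivative_def] by blast
  then have "((\<lambda>s. L (?\<gamma> s)) has_vector_derivative ?D (?\<gamma> \<theta>) (1, ?y)) (at \<theta> within {a..b})"
    unfolding has_vector_derivative_def by (simp only: linear_cmul[OF lin])
  moreover have "(\<Sum>k\<in>UNIV. pd_slot L k (?\<gamma> \<theta>) \<bullet> ?y $ k) =
      (\<Sum>i=0..m. pd_slot L (e i) (?\<gamma> \<theta>) \<bullet> nth_deriv {a..b} (Suc i) q \<theta>)"
    using e by (subst sum.reindex_bij_betw[OF e, symmetric])
      (auto simp: bij_betw_def the_inv_into_f_f intro!: sum.cong)
  ultimately show ?thesis
    by (simp add: frechet_derivative_Lagrangian[OF L z \<open>a < b\<close>])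
qed

section \<open>The fractional kernel\<close>

text \<open>
  The \<open>l\<close>-th derivative of the weight $(t - s)^{\alpha - 1}$ for \<open>s < t\<close>. The rising factorial takes
  the place of $\Gamma(l - \alpha + 1) / \Gamma(1 - \alpha)$, because it also makes sense for
  \<open>\<alpha> = 1\<close>, where it gives \<open>0\<close> for \<open>l \<ge> 1\<close>.
\<close>

definition kernel_deriv :: "real \<Rightarrow> real \<Rightarrow> nat \<Rightarrow> real \<Rightarrow> real" where
  "kernel_deriv \<alpha> t l s = pochhammer (1 - \<alpha>) l * (t - s) powr (\<alpha> - 1 - real l)"

lemma kernel_deriv_has_real_derivative:
  assumes "s < t"
  shows "(kernel_deriv \<alpha> t l has_real_derivative kernel_deriv \<alpha> t (Suc l) s) (at s within S)"
proof -
  have "((\<lambda>s. t - s) has_real_derivative -1) (at s)"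
    by (auto intro!: derivative_eq_intros)
  from DERIV_fun_powr[OF this, of "\<alpha> - 1 - real l"] assms
  have "((\<lambda>s. (t - s) powr (\<alpha> - 1 - real l)) has_real_derivative
      (1 - \<alpha> + real l) * (t - s) powr (\<alpha> - 1 - real (Suc l))) (at s)"
    by (simp add: algebra_simps)
  from DERIV_cmult[OF this, of "pochhammer (1 - \<alpha>) l"] show ?thesis
    unfolding kernel_deriv_def pochhammer_Suc
    by (auto simp: mult.assoc intro: has_field_derivative_at_within)
qed

lemma kernel_deriv_eq:
  assumes "s < t" "0 < \<alpha>" "\<alpha> \<le> 1" "l \<ge> 1"
  shows "kernel_deriv \<alpha> t l s =
    (t - s) powr (\<alpha> - 1) * (Gamma (real l - \<alpha> + 1) / ((t - s) ^ l * Gamma (1 - \<alpha>)))"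
proof -
  have "(t - s) powr (\<alpha> - 1 - real l) = (t - s) powr (\<alpha> - 1) / (t - s) ^ l"
    using assms by (simp add: powr_diff powr_realpow)
  moreover have "pochhammer (1 - \<alpha>) l = Gamma (real l - \<alpha> + 1) / Gamma (1 - \<alpha>)"
  proof (cases "\<alpha> = 1")
    case True
    then show ?thesis using assms by (simp add: pochhammer_0_left)
  next
    case False
    then have "1 - \<alpha> \<notin> \<int>\<^sub>\<le>\<^sub>0" using assms by (auto elim!: nonpos_Ints_cases)
    then show ?thesis by (simp add: pochhammer_Gamma algebra_simps)
  qed
  ultimately show ?thesis by (simp add: kernel_deriv_def mult_ac)
qed

text \<open>
  The left-hand side is $\sum_i (-1)^i \frac{d^i}{ds^i} (w \, \partial_{i+2} L)$ with
  $w = (t - s)^{\alpha - 1}$, expanded by Leibniz' rule. The terms with undifferentiated \<open>w\<close> make up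
  \<open>psi\<close> with index \<open>0\<close>, those with \<open>w'\<close> and with higher derivatives of \<open>w\<close> the two sums of the force.
\<close>

lemma weighted_Euler_Lagrange_eq_psi_minus_force:
  fixes L :: "real \<times> ((real^'n)^'k::finite) \<Rightarrow> real" and q :: "real \<Rightarrow> real^'n"
    and S :: "real set" and e :: "nat \<Rightarrow> 'k" and m :: nat
  defines "p \<equiv> \<lambda>i s. pd_slot L (e i) (jet e m S q s)"
  assumes "s < t" "0 < \<alpha>" "\<alpha> \<le> 1"
  shows "(\<Sum>i=0..m. (-1) ^ i *\<^sub>R
        (\<Sum>l\<le>i. real (i choose l) *\<^sub>R (kernel_deriv \<alpha> t l s *\<^sub>R nth_deriv S (i - l) (p i) s))) =
     (t - s) powr (\<alpha> - 1) *\<^sub>R (psi L e m S q 0 s - fractional_force L e m \<alpha> S t q s)"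
proof -
  define w where "w = (t - s) powr (\<alpha> - 1)"
  define g where "g l = Gamma (real l - \<alpha> + 1) / ((t - s) ^ l * Gamma (1 - \<alpha>))" for l
  define f where "f i k = nth_deriv S k (p i) s" for i k
  have k0: "kernel_deriv \<alpha> t 0 s = w" by (simp add: kernel_deriv_def w_def)
  have k1: "kernel_deriv \<alpha> t (Suc 0) s = w * ((1 - \<alpha>) / (t - s))"
    using assms by (simp add: kernel_deriv_def w_def powr_diff power2_eq_square mult_ac)
  have k2: "kernel_deriv \<alpha> t l s = w * g l" if "l \<ge> 1" for l
    using kernel_deriv_eq[OF assms(2-4) that] by (simp add: w_def g_def)
  have split: "(-1) ^ i *\<^sub>R (\<Sum>l\<le>i. real (i choose l) *\<^sub>R (kernel_deriv \<alpha> t l s *\<^sub>R f i (i - l))) =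
      w *\<^sub>R ((-1) ^ i *\<^sub>R f i i
        - ((1 - \<alpha>) / (t - s)) *\<^sub>R ((real i * (-1) ^ (i - 1)) *\<^sub>R f i (i - 1))
        - (\<Sum>l=2..i. ((-1) ^ (i - 1) * g l * real (i choose (i - l))) *\<^sub>R f i (i - l)))" for i
  proof (cases i)
    case 0
    then show ?thesis by (simp add: k0)
  next
    case (Suc n)
    have set: "{..i} = insert 0 (insert 1 {2..i})" using Suc by auto
    have "(\<Sum>l=2..i. real (i choose l) *\<^sub>R (kernel_deriv \<alpha> t l s *\<^sub>R f i (i - l))) =
        w *\<^sub>R (\<Sum>l=2..i. (g l * real (i choose (i - l))) *\<^sub>R f i (i - l))"
      unfolding scaleR_sum_right
      by (intro sum.cong) (auto simp: k2 binomial_symmetric[symmetric] mult_ac)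
    then have "(\<Sum>l\<le>i. real (i choose l) *\<^sub>R (kernel_deriv \<alpha> t l s *\<^sub>R f i (i - l))) =
        w *\<^sub>R (f i i + ((1 - \<alpha>) / (t - s)) *\<^sub>R (real i *\<^sub>R f i (i - 1)) +
          (\<Sum>l=2..i. (g l * real (i choose (i - l))) *\<^sub>R f i (i - l)))"
      unfolding set by (simp add: k0 k1 scaleR_add_right mult_ac)
    moreover have "(-1) ^ i = - ((-1::real) ^ (i - 1))" using Suc by simp
    ultimately show ?thesis
      by (simp add: scaleR_add_right scaleR_diff_right scaleR_sum_right sum_negf mult_ac)
  qed
  have zero: "{0..m} = insert 0 {1..m}" by auto
  have "psi L e m S q 0 s = (\<Sum>i=0..m. (-1) ^ i *\<^sub>R f i i)"
    by (simp add: psi_def f_def p_def)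
  moreover have "fractional_force L e m \<alpha> S t q s =
      (\<Sum>i=0..m. ((1 - \<alpha>) / (t - s)) *\<^sub>R ((real i * (-1) ^ (i - 1)) *\<^sub>R f i (i - 1)))
      + (\<Sum>i=0..m. \<Sum>l=2..i. ((-1) ^ (i - 1) * g l * real (i choose (i - l))) *\<^sub>R f i (i - l))"
  proof -
    have "(\<Sum>i=0..m. \<Sum>l=2..i. ((-1) ^ (i - 1) * g l * real (i choose (i - l))) *\<^sub>R f i (i - l)) =
        (\<Sum>i=2..m. \<Sum>l=2..i. ((-1) ^ (i - 1) * g l * real (i choose (i - l))) *\<^sub>R f i (i - l))"
      by (intro sum.mono_neutral_right) auto
    then show ?thesis
      unfolding zero by (simp add: fractional_force_def f_def p_def g_def scaleR_sum_right)
  qed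
  ultimately show ?thesis
    unfolding f_def[symmetric] w_def[symmetric] split
    by (simp only: scaleR_sum_right[symmetric] sum_subtractf sum.distrib diff_diff_eq)
qed

section \<open>The higher-order DuBois-Reymond condition\<close>

theorem theorem10:
  fixes L :: "real \<times> ((real^'n)^'k) \<Rightarrow> real"
    and e :: "nat \<Rightarrow> 'k::finite"
    and q :: "real \<Rightarrow> real^'n"
    and qa :: "nat \<Rightarrow> real^'n"
    and m :: nat
    and \<alpha> a b t :: real
  assumes "m \<ge> 1"
    and "CARD('k) = m + 1"
    and "bij_betw e {0..m} UNIV"
    and "0 < \<alpha>" and "\<alpha> \<le> 1"
    and "a < t" and "t \<le> b"
    and "C_class_on (2 * m) ({a..b} \<times> UNIV) L"
    and "C_class_on (2 * m) {a..b} q"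
    and "is_solution L e m \<alpha> a b t qa q"
  shows "\<forall>\<theta>\<in>{a..<t}.
    ((\<lambda>s. L (jet e m {a..b} q s) - (\<Sum>j=1..m. psi L e m {a..b} q j s \<bullet> nth_deriv {a..b} j q s))
      has_real_derivative
        pd_time {a..b} L (jet e m {a..b} q \<theta>)
        + fractional_force L e m \<alpha> {a..b} t q \<theta> \<bullet> nth_deriv {a..b} 1 q \<theta>)
      (at \<theta> within {a..b})"
proof
  fix \<theta> assume \<theta>: "\<theta> \<in> {a..<t}"
  then have \<theta>ab: "\<theta> \<in> {a..b}" and "a < b" using assms(6,7) by auto
  let ?S = "{a..b}"
  let ?\<gamma> = "jet e m ?S q"
  define p where "p i s = pd_slot L (e i) (?\<gamma> s)" for i s
  have L: "C_class_on (Suc m) (?S \<times> UNIV) L"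
    by (rule C_class_on_mono[OF assms(8)]) (use assms(1) in simp)
  then have diffL: "L differentiable_on ?S \<times> UNIV" by simp
  have q: "C_curve (2 * m) ?S q" by (rule C_class_on_imp_C_curve[OF assms(9)])
  have p: "C_curve m ?S (p i)" for i
    unfolding p_def
    by (rule C_curve_pd_slot[OF L C_curve_jet[OF \<open>a < b\<close> assms(3) q]]) (auto simp: jet_def)

  \<comment> \<open>\<open>P i j\<close> is the \<open>j\<close>-th derivative of the weighted coefficient \<open>(t - s) powr (\<alpha> - 1) *\<^sub>R p i s\<close>.\<close>
  define P where "P i j s =
    (\<Sum>l\<le>j. real (j choose l) *\<^sub>R (kernel_deriv \<alpha> t l s *\<^sub>R nth_deriv ?S (j - l) (p i) s))" for i j s
  have "(\<Sum>i=0..m. (-1) ^ i *\<^sub>R P i i \<theta>) = 0"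
    \<comment> \<open>The derivatives of an admissible variation up to order \<open>m\<close> are of class $C^{2m}$, as are those
      of a curve of class $C^{3m}$.\<close>
  proof (rule higher_order_Euler_Lagrange[where N = "3 * m" and P = P, OF assms(6,7) _ _ _ _ \<theta>])
    show "m \<le> 3 * m" by simp
  next
    fix i j s assume ij: "j < i" "i \<le> m" and s: "s \<in> {a..<t}"
    show "(P i j has_vector_derivative P i (Suc j) s) (at s within {a..<t})"
      unfolding P_def
    proof (rule Leibniz_has_vector_derivative[where f = "\<lambda>k. nth_deriv ?S k (p i)"])
      fix l assume "l \<le> j"
      show "(kernel_deriv \<alpha> t l has_real_derivative kernel_deriv \<alpha> t (Suc l) s) (at s within {a..<t})"
        using s by (simp add: kernel_deriv_has_real_derivative)
      have "(nth_deriv ?S l (p i) has_vector_derivative nth_deriv ?S (Suc l) (p i) s) (at s within ?S)"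
        using nth_deriv_has_vector_derivative[OF \<open>a < b\<close> p] ij s \<open>l \<le> j\<close> assms(7) by auto
      then show "(nth_deriv ?S l (p i) has_vector_derivative nth_deriv ?S (Suc l) (p i) s) (at s within {a..<t})"
        by (rule has_vector_derivative_within_subset) (use assms(7) in auto)
    qed
  next
    fix i assume i: "i \<le> m"
    have "continuous_on {a..<t} (kernel_deriv \<alpha> t l)" for l
      using kernel_deriv_has_real_derivative by (intro DERIV_continuous_on) auto
    moreover have "continuous_on {a..<t} (nth_deriv ?S (i - l) (p i))" for l
    proof (rule continuous_on_subset)
      show "continuous_on ?S (nth_deriv ?S (i - l) (p i))"
        using C_curve_imp_continuous_on[OF C_curve_nth_deriv[OF \<open>a < b\<close> p, of "i - l"]] i by auto
    qed (use assms(7) in auto)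
    ultimately show "continuous_on {a..<t} (P i i)"
      unfolding P_def by (intro continuous_intros)
  next
    fix h :: "real \<Rightarrow> real^'n"
    assume h: "C_curve (3 * m) ?S h" and h0: "\<And>i. i \<le> 3 * m \<Longrightarrow> nth_deriv ?S i h a = 0"
    have "C_class_on (2 * m) ?S (nth_deriv ?S i h)" if "i \<le> m" for i
    proof (rule C_curve_imp_C_class_on[OF \<open>a < b\<close>], rule C_curve_mono)
      show "C_curve (3 * m - i) ?S (nth_deriv ?S i h)"
        using that by (intro C_curve_nth_deriv \<open>a < b\<close> h) simp
    qed (use that in simp)
    then have "admissible_variation m a b h"
      using h0 by (simp add: admissible_variation_def)
    then have "first_variation L e m \<alpha> a b t q h = 0"
      using assms(10) by (simp add: is_solution_def)
    moreover have "Gamma \<alpha> \<noteq> 0" using Gamma_real_pos[OF assms(4)] by simp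
    ultimately have "integral {a..t} (\<lambda>s. (\<Sum>i=0..m. p i s \<bullet> nth_deriv ?S i h s) * (t - s) powr (\<alpha> - 1)) = 0"
      by (simp add: first_variation_def p_def)
    then show "integral {a..t} (\<lambda>s. \<Sum>i=0..m. P i 0 s \<bullet> nth_deriv ?S i h s) = 0"
      by (simp add: P_def kernel_deriv_def sum_distrib_left mult.commute)
  qed
  moreover have "(\<Sum>i=0..m. (-1) ^ i *\<^sub>R P i i \<theta>) =
      (t - \<theta>) powr (\<alpha> - 1) *\<^sub>R (psi L e m ?S q 0 \<theta> - fractional_force L e m \<alpha> ?S t q \<theta>)"
    using weighted_Euler_Lagrange_eq_psi_minus_force[
        where L = L and e = e and m = m and S = ?S and q = q and s = \<theta>, OF _ assms(4,5)] \<theta>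
    by (simp add: P_def p_def[abs_def])
  ultimately have EL: "psi L e m ?S q 0 \<theta> = fractional_force L e m \<alpha> ?S t q \<theta>"
    using \<theta> by simp

  \<comment> \<open>The same summation by parts, now with the unweighted coefficients and with \<open>q'\<close> in the role of the
    test curve.\<close>
  have "((\<lambda>s. \<Sum>j=1..m. (\<Sum>i=0..m-j. (-1) ^ i *\<^sub>R nth_deriv ?S i (p (i + j)) s) \<bullet> nth_deriv ?S (Suc (j - 1)) q s)
     has_vector_derivative
       (\<Sum>i=0..m. nth_deriv ?S 0 (p i) \<theta> \<bullet> nth_deriv ?S (Suc i) q \<theta>)
       - (\<Sum>i=0..m. (-1) ^ i *\<^sub>R nth_deriv ?S i (p i) \<theta>) \<bullet> nth_deriv ?S (Suc 0) q \<theta>) (at \<theta> within ?S)"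
  proof (rule momentum_derivative)
    fix i j assume "j < i" "i \<le> m"
    then show "(nth_deriv ?S j (p i) has_vector_derivative nth_deriv ?S (Suc j) (p i) \<theta>) (at \<theta> within ?S)"
      by (intro nth_deriv_has_vector_derivative[OF \<open>a < b\<close> p _ \<theta>ab]) simp
  next
    fix j assume "j < m"
    then show "(nth_deriv ?S (Suc j) q has_vector_derivative nth_deriv ?S (Suc (Suc j)) q \<theta>) (at \<theta> within ?S)"
      by (intro nth_deriv_has_vector_derivative[OF \<open>a < b\<close> q _ \<theta>ab]) simp
  qed
  moreover have "(\<Sum>j=1..m. (\<Sum>i=0..m-j. (-1) ^ i *\<^sub>R nth_deriv ?S i (p (i + j)) s) \<bullet> nth_deriv ?S (Suc (j - 1)) q s)
      = (\<Sum>j=1..m. psi L e m ?S q j s \<bullet> nth_deriv ?S j q s)" for s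
    by (intro sum.cong) (auto simp del: nth_deriv.simps simp: psi_def p_def[abs_def])
  moreover have "(\<Sum>i=0..m. (-1) ^ i *\<^sub>R nth_deriv ?S i (p i) \<theta>) = psi L e m ?S q 0 \<theta>"
    by (simp add: psi_def p_def[abs_def])
  ultimately have M: "((\<lambda>s. \<Sum>j=1..m. psi L e m ?S q j s \<bullet> nth_deriv ?S j q s) has_vector_derivative
      (\<Sum>i=0..m. p i \<theta> \<bullet> nth_deriv ?S (Suc i) q \<theta>)
      - fractional_force L e m \<alpha> ?S t q \<theta> \<bullet> nth_deriv ?S 1 q \<theta>) (at \<theta> within ?S)"
    by (simp only: EL nth_deriv.simps(1) One_nat_def)
  have "((\<lambda>s. L (?\<gamma> s)) has_vector_derivative pd_time ?S L (?\<gamma> \<theta>) +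
      (\<Sum>i=0..m. p i \<theta> \<bullet> nth_deriv ?S (Suc i) q \<theta>)) (at \<theta> within ?S)"
    unfolding p_def
    by (rule Lagrangian_along_jet_derivative[OF \<open>a < b\<close> assms(3) q _ diffL \<theta>ab]) (use assms(1) in simp)
  from has_vector_derivative_diff[OF this M]
  show "((\<lambda>s. L (?\<gamma> s) - (\<Sum>j=1..m. psi L e m ?S q j s \<bullet> nth_deriv ?S j q s))
      has_real_derivative
        pd_time ?S L (?\<gamma> \<theta>) + fractional_force L e m \<alpha> ?S t q \<theta> \<bullet> nth_deriv ?S 1 q \<theta>)
      (at \<theta> within ?S)"
    by (simp add: has_real_derivative_iff_has_vector_derivative del: nth_deriv.simps)
qed

end
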